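(* Let $X$ be a complex Banach space and let $T \in \mathcal{B}(X)$. Then $$\sigma_{desc}(T)= \sigma^e_{desc}(T)\cup \overline{\mathcal{S}(T^* )}.$$ In particular, if $T^*$ has SVEP, then $$\sigma_{desc}(T)=\sigma^e_{desc}(T).$$
   Context: $\mathcal{B}(X)$ is the Banach algebra of all bounded linear operators on the complex Banach space $X$; $R(T)$ denotes the range of $T$; $T^*$ is the (Banach space) adjoint of $T$, acting on the dual space $X^*$; $\lambda - T$ means $\lambda I - T$; $\mathbb{N}$ includes $0$ and $T^0=I$; the bar denotes closure in $\mathbb{C}$. For $T\in\mathcal{B}(X)$ and $n\in\mathbb{N}$ put $c_n(T)=\dim\big(R(T^n)/R(T^{n+1})\big)$. The descent of $T$ is $d(T)=\inf\{n\in\mathbb{N}: c_n(T)=0\}=\min\{q: R(T^q)=R(T^{q+1})\}$, and the essential descent of $T$ is $d_e(T)=\inf\{n\in\mathbb{N}: c_n(T)<\infty\}$, where the infimum over the empty set is $\infty$. The descent spectrum is $\sigma_{desc}(T)=\{\lambda\in\mathbb{C}: d(\lambda-T)=\infty\}$ and the essential descent spectrum is $\sigma^e_{desc}(T)=\{\lambda\in\mathbb{C}: d_e(\lambda-T)=\infty\}$. A bounded operator $S$ on a complex Banach space $Y$ has the single-valued extension property (SVEP) at $\lambda_0\in\mathbb{C}$ if for every open disc $\mathcal{U}$ centered at $\lambda_0$ the only analytic function $f:\mathcal{U}\to Y$ satisfying $(\lambda I-S)f(\lambda)=0$ for all $\lambda\in\mathcal{U}$ is $f\equiv 0$. Let $\mathcal{S}(S)=\{\lambda\in\mathbb{C}: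 S \text{ does not have the SVEP at } \lambda\}$. The operator $S$ has SVEP if $\mathcal{S}(S)=\emptyset$. *)

theory Defs
  imports "HOL-Analysis.Analysis" "HOL-Library.Extended_Nat"
begin

section \<open>Complex Banach spaces\<close>

class complex_normed_vector = real_normed_vector +
  fixes scaleC :: "complex \<Rightarrow> 'a \<Rightarrow> 'a" (infixr "*\<^sub>C" 75)
  assumes scaleC_add_right: "c *\<^sub>C (x + y) = c *\<^sub>C x + c *\<^sub>C y"
    and scaleC_add_left: "(c + d) *\<^sub>C x = c *\<^sub>C x + d *\<^sub>C x"
    and scaleC_scaleC: "c *\<^sub>C (d *\<^sub>C x) = (c * d) *\<^sub>C x"
    and scaleC_of_real: "complex_of_real r *\<^sub>C x = r *\<^sub>R x"
    and norm_scaleC: "norm (c *\<^sub>C x) = cmod c * norm x"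

class cbanach = complex_normed_vector + banach

instantiation complex :: cbanach
begin

definition scaleC_complex :: "complex \<Rightarrow> complex \<Rightarrow> complex"
  where "scaleC_complex c x = c * x"

instance
  by standard (auto simp: scaleC_complex_def algebra_simps norm_mult scaleR_conv_of_real)

end

lemma scaleC_one [simp]: "1 *\<^sub>C x = (x :: 'a::complex_normed_vector)"
  using scaleC_of_real[of 1 x] by simp

interpretation complex_vec: vector_space "scaleC :: complex \<Rightarrow> 'a \<Rightarrow> 'a::complex_normed_vector"
  by unfold_locales (simp_all add: scaleC_add_right scaleC_add_left scaleC_scaleC)

lemma bounded_linear_scaleC: "bounded_linear (\<lambda>x :: 'a::complex_normed_vector. c *\<^sub>C x)"
proof (rule bounded_linear_intro[where K = "cmod c"])
  fix r and x :: 'a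
  show "c *\<^sub>C (r *\<^sub>R x) = r *\<^sub>R (c *\<^sub>C x)"
    by (simp add: scaleC_of_real[symmetric] scaleC_scaleC mult.commute)
qed (simp_all add: scaleC_add_right norm_scaleC mult.commute)


section \<open>Bounded complex-linear operators\<close>

definition bounded_clinear ::
    "('a::complex_normed_vector \<Rightarrow> 'b::complex_normed_vector) \<Rightarrow> bool"
  where "bounded_clinear f \<longleftrightarrow> bounded_linear f \<and> (\<forall>c x. f (c *\<^sub>C x) = c *\<^sub>C f x)"

typedef (overloaded) ('a, 'b) cblinfun =
  "{f :: 'a::complex_normed_vector \<Rightarrow> 'b::complex_normed_vector. bounded_clinear f}"
  morphisms cblinfun_apply Cblinfun
  by (rule exI[where x = "\<lambda>x. 0"]) (simp add: bounded_clinear_def)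

setup_lifting type_definition_cblinfun

lemma cblinfun_eqI: "(\<And>x. cblinfun_apply f x = cblinfun_apply g x) \<Longrightarrow> f = g"
  by transfer auto

lemma bounded_clinear_cblinfun_apply: "bounded_clinear (cblinfun_apply f)"
  using cblinfun_apply by blast

lemma bounded_linear_cblinfun_apply: "bounded_linear (cblinfun_apply f)"
  using bounded_clinear_cblinfun_apply unfolding bounded_clinear_def by blast

lemma cblinfun_apply_scaleC: "cblinfun_apply f (c *\<^sub>C x) = c *\<^sub>C cblinfun_apply f x"
  using bounded_clinear_cblinfun_apply unfolding bounded_clinear_def by blast

lemma onorm_scaleC:
  fixes f :: "'a::real_normed_vector \<Rightarrow> 'b::complex_normed_vector"
  assumes f: "bounded_linear f"
  shows "onorm (\<lambda>x. c *\<^sub>C f x) = cmod c * onorm f"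
proof -
  have bd: "onorm (\<lambda>x. d *\<^sub>C g x) \<le> cmod d * onorm g" if g: "bounded_linear g"
    for d and g :: "'a \<Rightarrow> 'b"
  proof (rule onorm_bound)
    show "0 \<le> cmod d * onorm g" using g by (simp add: onorm_pos_le)
    fix x
    show "norm (d *\<^sub>C g x) \<le> cmod d * onorm g * norm x"
      using mult_left_mono[OF onorm[OF g, of x], of "cmod d"]
      by (simp add: norm_scaleC mult.assoc)
  qed
  show ?thesis
  proof (cases "c = 0")
    case True
    then show ?thesis by (simp add: onorm_zero)
  next
    case False
    have "bounded_linear (\<lambda>x. c *\<^sub>C f x)"
      by (rule bounded_linear_compose[OF bounded_linear_scaleC f])
    from bd[OF this, of "inverse c"] False
    have "onorm f \<le> inverse (cmod c) * onorm (\<lambda>x. c *\<^sub>C f x)"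
      by (simp add: scaleC_scaleC norm_inverse)
    with False have "cmod c * onorm f \<le> onorm (\<lambda>x. c *\<^sub>C f x)"
      by (simp add: field_simps)
    with bd[OF f, of c] show ?thesis by simp
  qed
qed

instantiation cblinfun :: (complex_normed_vector, complex_normed_vector) complex_normed_vector
begin

lift_definition norm_cblinfun :: "('a, 'b) cblinfun \<Rightarrow> real" is onorm .

lift_definition zero_cblinfun :: "('a, 'b) cblinfun" is "\<lambda>x. 0"
  by (simp add: bounded_clinear_def)

lift_definition plus_cblinfun :: "('a, 'b) cblinfun \<Rightarrow> ('a, 'b) cblinfun \<Rightarrow> ('a, 'b) cblinfun"
  is "\<lambda>f g x. f x + g x"
  by (simp add: bounded_clinear_def bounded_linear_add scaleC_add_right)

lift_definition minus_cblinfun :: "('a, 'b) cblinfun \<Rightarrow> ('a, 'b) cblinfun \<Rightarrow> ('a, 'b) cblinfun"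
  is "\<lambda>f g x. f x - g x"
  by (simp add: bounded_clinear_def bounded_linear_sub complex_vec.scale_right_diff_distrib)

lift_definition uminus_cblinfun :: "('a, 'b) cblinfun \<Rightarrow> ('a, 'b) cblinfun" is "\<lambda>f x. - f x"
  by (simp add: bounded_clinear_def bounded_linear_minus)

lift_definition scaleR_cblinfun :: "real \<Rightarrow> ('a, 'b) cblinfun \<Rightarrow> ('a, 'b) cblinfun"
  is "\<lambda>r f x. r *\<^sub>R f x"
  by (auto simp: bounded_clinear_def bounded_linear_const_scaleR)
    (simp add: scaleC_of_real[symmetric] scaleC_scaleC mult.commute)

lift_definition scaleC_cblinfun :: "complex \<Rightarrow> ('a, 'b) cblinfun \<Rightarrow> ('a, 'b) cblinfun"
  is "\<lambda>c f x. c *\<^sub>C f x"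
  by (auto simp: bounded_clinear_def scaleC_scaleC mult.commute
      intro: bounded_linear_compose[OF bounded_linear_scaleC])

definition dist_cblinfun :: "('a, 'b) cblinfun \<Rightarrow> ('a, 'b) cblinfun \<Rightarrow> real"
  where "dist_cblinfun f g = norm (f - g)"

definition sgn_cblinfun :: "('a, 'b) cblinfun \<Rightarrow> ('a, 'b) cblinfun"
  where "sgn_cblinfun f = inverse (norm f) *\<^sub>R f"

definition uniformity_cblinfun :: "(('a, 'b) cblinfun \<times> ('a, 'b) cblinfun) filter"
  where "uniformity_cblinfun = (INF e\<in>{0 <..}. principal {(x, y). dist x y < e})"

definition open_cblinfun :: "('a, 'b) cblinfun set \<Rightarrow> bool"
  where "open_cblinfun S = (\<forall>x\<in>S. \<forall>\<^sub>F (x', y) in uniformity. x' = x \<longrightarrow> y \<in> S)"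

instance
  apply standard
  unfolding dist_cblinfun_def open_cblinfun_def sgn_cblinfun_def uniformity_cblinfun_def
  by (rule refl | (transfer, force simp: bounded_clinear_def onorm_triangle onorm_scaleR
        onorm_scaleC onorm_eq_0 scaleC_add_right scaleC_add_left scaleC_scaleC scaleC_of_real
        algebra_simps))+

end

lemma norm_cblinfun: "norm (cblinfun_apply f x) \<le> norm f * norm x"
  using onorm[OF bounded_linear_cblinfun_apply] by (simp add: norm_cblinfun.rep_eq)

lemma norm_cblinfun_bound:
  "(\<And>x. norm (cblinfun_apply f x) \<le> b * norm x) \<Longrightarrow> 0 \<le> b \<Longrightarrow> norm f \<le> b"
  by (simp add: norm_cblinfun.rep_eq onorm_bound)

instance cblinfun :: (complex_normed_vector, cbanach) cbanach
proof
  fix X :: "nat \<Rightarrow> ('a, 'b) cblinfun"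
  assume X: "Cauchy X"
  define Y where "Y n = Blinfun (cblinfun_apply (X n))" for n
  have Y: "blinfun_apply (Y n) = cblinfun_apply (X n)" for n
    by (simp add: Y_def bounded_linear_Blinfun_apply bounded_linear_cblinfun_apply)
  have nY: "norm (Y m - Y n) = norm (X m - X n)" for m n
  proof -
    have "blinfun_apply (Y m - Y n) = cblinfun_apply (X m - X n)"
      by (auto simp: blinfun.diff_left Y minus_cblinfun.rep_eq)
    then show ?thesis by (simp add: norm_cblinfun.rep_eq norm_blinfun.rep_eq)
  qed
  have "Cauchy Y" using X by (simp add: Cauchy_def dist_norm nY)
  then obtain L where L: "Y \<longlonglongrightarrow> L"
    using Cauchy_convergent_iff convergent_def by blast
  have pt: "(\<lambda>n. cblinfun_apply (X n) x) \<longlonglongrightarrow> blinfun_apply L x" for x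
    using blinfun.tendsto[OF L tendsto_const[of x]] by (simp add: Y)
  have "blinfun_apply L (c *\<^sub>C x) = c *\<^sub>C blinfun_apply L x" for c x
  proof (rule LIMSEQ_unique[OF pt])
    show "(\<lambda>n. cblinfun_apply (X n) (c *\<^sub>C x)) \<longlonglongrightarrow> c *\<^sub>C blinfun_apply L x"
      unfolding cblinfun_apply_scaleC
      by (rule bounded_linear.tendsto[OF bounded_linear_scaleC pt])
  qed
  then have "bounded_clinear (blinfun_apply L)"
    by (simp add: bounded_clinear_def blinfun.bounded_linear_right)
  then have C: "cblinfun_apply (Cblinfun (blinfun_apply L)) = blinfun_apply L"
    by (simp add: Cblinfun_inverse)
  have "norm (X n - Cblinfun (blinfun_apply L)) = norm (Y n - L)" for n
  proof -
    have "blinfun_apply (Y n - L) = cblinfun_apply (X n - Cblinfun (blinfun_apply L))"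
      by (auto simp: blinfun.diff_left Y minus_cblinfun.rep_eq C)
    then show ?thesis by (simp add: norm_cblinfun.rep_eq norm_blinfun.rep_eq)
  qed
  with L have "X \<longlonglongrightarrow> Cblinfun (blinfun_apply L)"
    by (simp add: LIMSEQ_iff)
  then show "convergent X" by (auto simp: convergent_def)
qed

lift_definition id_cblinfun :: "('a::complex_normed_vector, 'a) cblinfun" is "\<lambda>x. x"
  by (simp add: bounded_clinear_def)

lift_definition cblinfun_compose ::
    "('b::complex_normed_vector, 'c::complex_normed_vector) cblinfun \<Rightarrow>
      ('a::complex_normed_vector, 'b) cblinfun \<Rightarrow> ('a, 'c) cblinfun"
  is "\<lambda>f g x. f (g x)"
  by (auto simp: bounded_clinear_def intro: bounded_linear_compose)

lemma norm_cblinfun_compose: "norm (cblinfun_compose f g) \<le> norm f * norm g"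
proof (rule norm_cblinfun_bound)
  fix x
  have "norm (cblinfun_apply f (cblinfun_apply g x)) \<le> norm f * norm (cblinfun_apply g x)"
    by (rule norm_cblinfun)
  also have "\<dots> \<le> norm f * (norm g * norm x)"
    by (intro mult_left_mono norm_cblinfun) simp
  finally show "norm (cblinfun_apply (cblinfun_compose f g) x) \<le> norm f * norm g * norm x"
    by (simp add: cblinfun_compose.rep_eq mult.assoc)
qed simp

text \<open>The dual space consists of the bounded complex-linear functionals, with the operator norm.\<close>

type_synonym 'a cdual = "('a, complex) cblinfun"

lift_definition banach_adjoint ::
    "('a::complex_normed_vector, 'b::complex_normed_vector) cblinfun \<Rightarrow> ('b cdual, 'a cdual) cblinfun"
  is "\<lambda>T \<phi>. cblinfun_compose \<phi> T"
proof -
  fix T :: "('a, 'b) cblinfun"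
  have "bounded_linear (\<lambda>\<phi> :: 'b cdual. cblinfun_compose \<phi> T)"
    by (rule bounded_linear_intro[where K = "norm T"])
      (auto intro!: cblinfun_eqI norm_cblinfun_compose
        simp: cblinfun_compose.rep_eq plus_cblinfun.rep_eq scaleR_cblinfun.rep_eq)
  moreover have "cblinfun_compose (c *\<^sub>C \<phi>) T = c *\<^sub>C cblinfun_compose \<phi> T"
    for c and \<phi> :: "'b cdual"
    by (rule cblinfun_eqI) (simp add: cblinfun_compose.rep_eq scaleC_cblinfun.rep_eq)
  ultimately show "bounded_clinear (\<lambda>\<phi> :: 'b cdual. cblinfun_compose \<phi> T)"
    by (simp add: bounded_clinear_def)
qed


section \<open>Descent and essential descent\<close>

text \<open>
  For a subspace \<open>W\<close> of \<open>V\<close>, the cosets of the elements of \<open>B\<close> form a basis of \<open>V / W\<close>, distinct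
  elements giving distinct cosets: a combination of cosets vanishes in the quotient iff the same
  combination of representatives lies in \<open>W\<close>.
\<close>

definition quotient_basis :: "'a::complex_normed_vector set \<Rightarrow> 'a set \<Rightarrow> 'a set \<Rightarrow> bool"
  where "quotient_basis V W B \<longleftrightarrow>
    B \<subseteq> V \<and>
    (\<forall>v\<in>V. \<exists>F u. finite F \<and> F \<subseteq> B \<and> v - (\<Sum>b\<in>F. u b *\<^sub>C b) \<in> W) \<and>
    (\<forall>F u. finite F \<and> F \<subseteq> B \<and> (\<Sum>b\<in>F. u b *\<^sub>C b) \<in> W \<longrightarrow> (\<forall>b\<in>F. u b = 0))"

text \<open>
  All bases of \<open>V / W\<close> have the same cardinality, so the infimum is that cardinality if there is a
  finite basis; otherwise it is the infimum of the empty set, which is \<open>\<infinity>\<close>.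
\<close>

definition quotient_dim :: "'a::complex_normed_vector set \<Rightarrow> 'a set \<Rightarrow> enat"
  where "quotient_dim V W = Inf {enat (card B) | B. finite B \<and> quotient_basis V W B}"

lemma quotient_basis_card_le:
  fixes W :: "'a::complex_normed_vector set"
  assumes W: "complex_vec.subspace W"
    and B: "finite B" "quotient_basis V W B" and C: "finite C" "quotient_basis V W C"
  shows "card C \<le> card B"
proof -
  have "\<exists>d. d \<in> complex_vec.span B \<and> c - d \<in> W" if "c \<in> C" for c
  proof -
    have "c \<in> V" using that C(2) by (auto simp: quotient_basis_def)
    then have "\<exists>F u. finite F \<and> F \<subseteq> B \<and> c - (\<Sum>b\<in>F. u b *\<^sub>C b) \<in> W"
      using B(2) unfolding quotient_basis_def by (elim conjE) (drule bspec)
    then obtain F u where F: "F \<subseteq> B" "c - (\<Sum>b\<in>F. u b *\<^sub>C b) \<in> W"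
      by (elim exE conjE)
    moreover have "(\<Sum>b\<in>F. u b *\<^sub>C b) \<in> complex_vec.span B"
      by (intro complex_vec.span_sum complex_vec.span_scale complex_vec.span_base) (use F in auto)
    ultimately show ?thesis by blast
  qed
  then obtain g where g: "\<And>c. c \<in> C \<Longrightarrow> g c \<in> complex_vec.span B" "\<And>c. c \<in> C \<Longrightarrow> c - g c \<in> W"
    by metis
  have zero: "\<forall>c\<in>C. u c = 0" if "(\<Sum>c\<in>C. u c *\<^sub>C g c) = 0" for u
  proof -
    have "(\<Sum>c\<in>C. u c *\<^sub>C c) = (\<Sum>c\<in>C. u c *\<^sub>C (c - g c)) + (\<Sum>c\<in>C. u c *\<^sub>C g c)"
      by (simp only: sum.distrib[symmetric] complex_vec.scale_right_diff_distrib diff_add_cancel)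
    also have "\<dots> = (\<Sum>c\<in>C. u c *\<^sub>C (c - g c))" by (simp add: that)
    also have "\<dots> \<in> W"
      by (intro complex_vec.subspace_sum[OF W] complex_vec.subspace_scale[OF W] g(2))
    finally have W': "(\<Sum>c\<in>C. u c *\<^sub>C c) \<in> W" .
    have "\<forall>F u. finite F \<and> F \<subseteq> C \<and> (\<Sum>b\<in>F. u b *\<^sub>C b) \<in> W \<longrightarrow> (\<forall>b\<in>F. u b = 0)"
      using C(2) unfolding quotient_basis_def by (elim conjE)
    from this[rule_format, of C u] W' C(1) show ?thesis by simp
  qed
  have inj: "inj_on g C"
  proof (rule inj_onI, rule ccontr)
    fix c d assume cd: "c \<in> C" "d \<in> C" "g c = g d" "c \<noteq> d"
    define u :: "'a \<Rightarrow> complex" where "u x = (if x = c then 1 else if x = d then -1 else 0)" for x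
    have "(\<Sum>x\<in>C. u x *\<^sub>C g x) = (\<Sum>x\<in>{c, d}. u x *\<^sub>C g x)"
      by (rule sum.mono_neutral_right) (simp_all add: C cd u_def)
    also have "\<dots> = 0" using cd by (simp add: u_def)
    finally have "(\<Sum>x\<in>C. u x *\<^sub>C g x) = 0" .
    then have "u c = 0" using zero[of u] cd(1) by simp
    then show False by (simp add: u_def)
  qed
  have ind: "complex_vec.independent (g ` C)"
  proof (rule complex_vec.independent_if_scalars_zero)
    fix f x assume f: "(\<Sum>x\<in>g ` C. f x *\<^sub>C x) = 0" and x: "x \<in> g ` C"
    have "(\<Sum>c\<in>C. f (g c) *\<^sub>C g c) = 0" using f by (simp add: sum.reindex[OF inj])
    from zero[OF this] x show "f x = 0" by blast
  qed (use C in simp)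
  have "card (g ` C) \<le> card B"
    using complex_vec.independent_span_bound[OF B(1) ind] g(1) by (simp add: image_subset_iff)
  then show ?thesis by (simp add: card_image[OF inj])
qed

lemma quotient_dim_eq_card:
  assumes "complex_vec.subspace W" "finite B" "quotient_basis V W B"
  shows "quotient_dim V W = enat (card B)"
  unfolding quotient_dim_def
proof (rule Inf_eqI)
  fix n assume "n \<in> {enat (card B) | B. finite B \<and> quotient_basis V W B}"
  then obtain C where "n = enat (card C)" "finite C" "quotient_basis V W C" by blast
  with quotient_basis_card_le[OF assms(1) this(2,3) assms(2,3)] show "enat (card B) \<le> n" by simp
next
  fix n assume "\<And>i. i \<in> {enat (card B) | B. finite B \<and> quotient_basis V W B} \<Longrightarrow> n \<le> i"
  with assms show "n \<le> enat (card B)" by blast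
qed

definition range_pow :: "('a::complex_normed_vector, 'a) cblinfun \<Rightarrow> nat \<Rightarrow> 'a set"
  where "range_pow T n = range (cblinfun_apply T ^^ n)"

definition descent_dim :: "('a::complex_normed_vector, 'a) cblinfun \<Rightarrow> nat \<Rightarrow> enat"
  where "descent_dim T n = quotient_dim (range_pow T n) (range_pow T (Suc n))"

definition descent :: "('a::complex_normed_vector, 'a) cblinfun \<Rightarrow> enat"
  where "descent T = Inf {enat n | n. descent_dim T n = 0}"

definition ess_descent :: "('a::complex_normed_vector, 'a) cblinfun \<Rightarrow> enat"
  where "ess_descent T = Inf {enat n | n. descent_dim T n < \<infinity>}"

definition descent_spectrum :: "('a::complex_normed_vector, 'a) cblinfun \<Rightarrow> complex set"
  where "descent_spectrum T = {\<mu>. descent (\<mu> *\<^sub>C id_cblinfun - T) = \<infinity>}"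

definition ess_descent_spectrum :: "('a::complex_normed_vector, 'a) cblinfun \<Rightarrow> complex set"
  where "ess_descent_spectrum T = {\<mu>. ess_descent (\<mu> *\<^sub>C id_cblinfun - T) = \<infinity>}"


section \<open>The single-valued extension property\<close>

text \<open>Analyticity of a vector-valued function on an open set: complex differentiability at each point.\<close>

definition vec_analytic_on :: "(complex \<Rightarrow> 'a::complex_normed_vector) \<Rightarrow> complex set \<Rightarrow> bool"
  where "vec_analytic_on f U \<longleftrightarrow> (\<forall>z\<in>U. \<exists>D. (f has_derivative (\<lambda>h. h *\<^sub>C D)) (at z))"

definition svep_at :: "('a::complex_normed_vector, 'a) cblinfun \<Rightarrow> complex \<Rightarrow> bool"
  where "svep_at S \<mu>\<^sub>0 \<longleftrightarrow>
    (\<forall>r>0. \<forall>f. vec_analytic_on f (ball \<mu>\<^sub>0 r) \<and>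
        (\<forall>\<mu>\<in>ball \<mu>\<^sub>0 r. cblinfun_apply (\<mu> *\<^sub>C id_cblinfun - S) (f \<mu>) = 0) \<longrightarrow>
      (\<forall>\<mu>\<in>ball \<mu>\<^sub>0 r. f \<mu> = 0))"

definition svep_failure_set :: "('a::complex_normed_vector, 'a) cblinfun \<Rightarrow> complex set"
  where "svep_failure_set S = {\<mu>. \<not> svep_at S \<mu>}"

definition svep :: "('a::complex_normed_vector, 'a) cblinfun \<Rightarrow> bool"
  where "svep S \<longleftrightarrow> svep_failure_set S = {}"

end

theory Submission
  imports Defs "HOL-Complex_Analysis.Complex_Analysis" "HOL-Probability.Discrete_Topology"
begin

text \<open>
  Write \<open>S = \<mu> - T\<close>. If \<open>R(S\<^sup>n) = R(S\<^bsup>n+1\<^esup>)\<close>, the open mapping principle allows solving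
  \<open>S\<^bsup>n+1\<^esup> y = S\<^sup>n x\<close> with \<open>\<parallel>y\<parallel> \<le> K \<parallel>x\<parallel>\<close>, and a geometric series shows that \<open>z - T\<close> is onto for
  \<open>0 < |z - \<mu>| < 1 / K\<close>. There \<open>z - T\<^sup>*\<close> is injective, so \<open>T\<^sup>*\<close> has the SVEP near \<open>\<mu>\<close>.

  If \<open>S\<close> has infinite descent but finite essential descent, then \<open>c\<^sub>k(S)\<close> is eventually a constant
  \<open>c > 0\<close>, which forces \<open>N(S) \<inter> R(S\<^sup>d) \<subseteq> R(S\<^sup>k)\<close> for all \<open>k\<close>. Solving
  \<open>S\<^sup>d x = S\<^bsup>d+1\<^esup> w + \<Sum>\<^sub>b u\<^sub>b S\<^sup>d b\<close> with bounds on \<open>w\<close> and \<open>u\<close>, the rules \<open>\<phi>\<^sub>0(x) = u\<^sub>c\<close> and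
  \<open>\<phi>\<^bsub>k+1\<^esub>(x) = \<phi>\<^sub>k(w)\<close> define functionals on all of \<open>X\<close> with \<open>\<phi>\<^sub>0 \<circ> S = 0\<close>, \<open>\<phi>\<^bsub>k+1\<^esub> \<circ> S = \<phi>\<^sub>k\<close> and
  geometric growth. Then \<open>\<Sum>\<^sub>k (\<mu> - z)\<^sup>k \<phi>\<^sub>k\<close> is a nonzero analytic function annihilated by \<open>z - T\<^sup>*\<close>,
  so the SVEP of \<open>T\<^sup>*\<close> fails at \<open>\<mu>\<close> itself.
\<close>

section \<open>Baire category and solutions of linear equations with norm bounds\<close>

lemma complete_Union_interior:
  fixes C :: "nat \<Rightarrow> 'a::complete_space set"
  assumes cl: "\<And>n. closed (C n)" and un: "(\<Union>n. C n) = UNIV"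
  shows "\<exists>n. interior (C n) \<noteq> {}"
proof (rule ccontr)
  assume neg: "\<not> ?thesis"
  have "completely_metrizable_space (euclidean :: 'a topology)"
    by (rule completely_metrizable_space_euclidean)
  then have "euclidean interior_of \<Union>(range C) = {}"
    by (intro Baire_category_alt) (use cl neg in auto)
  with un show False by simp
qed

text \<open>An open mapping argument, with Baire applied in the domain of \<open>A\<close> rather
  than in the target, where the range of \<open>B\<close> may fail to be closed. It yields
  approximate solutions of controlled norm; correcting the error repeatedly gives a convergent
  series of exact ones.\<close>

lemma bounded_linear_lift:
  fixes A :: "'a::banach \<Rightarrow> 'c::real_normed_vector" and B :: "'b::banach \<Rightarrow> 'c"
  assumes A: "bounded_linear A" and B: "bounded_linear B" and sub: "range A \<subseteq> range B"
  shows "\<exists>K>0. \<forall>x. \<exists>y. B y = A x \<and> norm y \<le> K * norm x"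
proof -
  interpret A: bounded_linear A by (rule A)
  interpret B: bounded_linear B by (rule B)
  define E where "E n = {x. \<exists>y. B y = A x \<and> norm y \<le> real n}" for n
  have "(\<Union>n. closure (E n)) = UNIV"
  proof -
    have "\<exists>n. x \<in> closure (E n)" for x
    proof -
      obtain y where "B y = A x" using sub by (metis imageE rangeI subsetD)
      moreover obtain n where "norm y \<le> real n" using real_arch_simple by blast
      ultimately have "x \<in> E n" by (auto simp: E_def)
      then show ?thesis using closure_subset by blast
    qed
    then show ?thesis by blast
  qed
  then obtain n where "interior (closure (E n)) \<noteq> {}"
    using complete_Union_interior[of "\<lambda>n. closure (E n)"] by auto
  then obtain x0 where "x0 \<in> interior (closure (E n))" by blast
  then obtain r where r: "r > 0" "ball x0 r \<subseteq> closure (E n)"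
    using mem_interior by blast
  \<comment> \<open>Subtracting points of \<open>E n\<close> near \<open>x0\<close> and near
    \<open>x0 + x\<close> moves the ball to the origin and doubles the bound.\<close>
  have near0: "\<exists>x' y. B y = A x' \<and> norm y \<le> 2 * real n \<and> norm (x - x') < e"
    if x: "norm x < r" and e: "e > 0" for x e
  proof -
    have "x0 \<in> closure (E n)" "x0 + x \<in> closure (E n)"
      using r x by (auto intro!: subsetD[OF r(2)] simp: dist_norm)
    then obtain p q where p: "p \<in> E n" "dist p x0 < e / 2" and q: "q \<in> E n" "dist q (x0 + x) < e / 2"
      unfolding closure_approachable using e by (meson half_gt_zero)
    then obtain s t where s: "B s = A p" "norm s \<le> real n" and t: "B t = A q" "norm t \<le> real n"
      by (auto simp: E_def)
    have "norm (x - (q - p)) < e"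
    proof -
      have "x - (q - p) = (p - x0) - (q - (x0 + x))" by simp
      also have "norm \<dots> \<le> norm (p - x0) + norm (q - (x0 + x))" by (rule norm_triangle_ineq4)
      finally show ?thesis using p q by (simp add: dist_norm)
    qed
    moreover have "norm (t - s) \<le> 2 * real n"
      using norm_triangle_ineq4[of t s] s t by simp
    ultimately show ?thesis
      by (intro exI[of _ "q - p"] exI[of _ "t - s"]) (simp add: A.diff B.diff s t)
  qed
  define M where "M = 4 * real n / r"
  have "M \<ge> 0" using r by (simp add: M_def)
  have "\<exists>x' y. B y = A x' \<and> norm y \<le> M * norm x \<and> norm (x - x') \<le> norm x / 2" for x
  proof (cases "x = 0")
    case True
    then show ?thesis by (intro exI[of _ 0]) (simp add: A.zero B.zero)
  next
    case False
    \<comment> \<open>Rescales \<open>x\<close> to norm \<open>r / 2\<close>; undoing this turns the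
      bound \<open>2 * real n\<close> into \<open>M * norm x\<close>.\<close>
    define c where "c = r / (2 * norm x)"
    have c: "c > 0" using r False by (simp add: c_def)
    have "norm (c *\<^sub>R x) < r" using r False by (simp add: c_def)
    from near0[OF this, of "c * norm x / 2"] obtain x' y where
      xy: "B y = A x'" "norm y \<le> 2 * real n" "norm (c *\<^sub>R x - x') < c * norm x / 2"
      using c False by auto
    have "norm (x - x' /\<^sub>R c) = norm (c *\<^sub>R x - x') / c"
    proof -
      have "x - x' /\<^sub>R c = (c *\<^sub>R x - x') /\<^sub>R c" using c by (simp add: scaleR_diff_right)
      then show ?thesis using c by (simp add: divide_inverse mult.commute)
    qed
    also have "\<dots> \<le> norm x / 2" using xy(3) c by (simp add: field_simps)
    finally have "norm (x - x' /\<^sub>R c) \<le> norm x / 2" .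
    moreover have "norm (y /\<^sub>R c) \<le> M * norm x"
    proof -
      have "norm (y /\<^sub>R c) = norm y / c" using c by (simp add: divide_inverse mult.commute)
      also have "\<dots> \<le> 2 * real n / c" using xy(2) c by (simp add: divide_right_mono)
      also have "\<dots> = M * norm x" using False r by (simp add: c_def M_def)
      finally show ?thesis .
    qed
    ultimately show ?thesis
      by (intro exI[of _ "x' /\<^sub>R c"] exI[of _ "y /\<^sub>R c"]) (simp add: A.scaleR B.scaleR xy)
  qed
  then obtain p q where pq: "\<And>x. B (q x) = A (p x)" "\<And>x. norm (q x) \<le> M * norm x"
      "\<And>x. norm (x - p x) \<le> norm x / 2"
    by metis
  \<comment> \<open>The geometric series contributes \<open>2 * M\<close>; the extra 1 keeps the
    constant positive when \<open>M = 0\<close>.\<close>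
  have "\<exists>y. B y = A x \<and> norm y \<le> (2 * M + 1) * norm x" for x
  proof -
    \<comment> \<open>The error left after \<open>k\<close> corrections. Each correction at least
      halves it, and \<open>B (q (s k))\<close> is the telescoping difference of \<open>A\<close>
      along it.\<close>
    define s where "s k = ((\<lambda>x. x - p x) ^^ k) x" for k
    have s: "norm (s k) \<le> norm x * (1/2) ^ k" for k
    proof (induction k)
      case (Suc k)
      have "norm (s (Suc k)) \<le> norm (s k) / 2" using pq(3)[of "s k"] by (simp add: s_def)
      with Suc show ?case by simp
    qed (simp add: s_def)
    have "norm (q (s k)) \<le> M * norm x * (1/2) ^ k" for k
      using order.trans[OF pq(2)[of "s k"] mult_left_mono[OF s[of k] \<open>M \<ge> 0\<close>]] by (simp add: mult.assoc)
    then have qs: "norm (norm (q (s k))) \<le> M * norm x * (1/2) ^ k" for k by simp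
    have ms: "(\<lambda>k. M * norm x * (1/2::real) ^ k) sums (M * norm x * 2)"
      using sums_mult[OF geometric_sums[of "1/2::real"], of "M * norm x"] by simp
    have sq: "summable (\<lambda>k. norm (q (s k)))"
      by (rule summable_comparison_test'[OF sums_summable[OF ms] qs])
    have nq: "(\<Sum>k. norm (q (s k))) \<le> M * norm x * 2"
      by (rule sums_le[OF _ summable_sums[OF sq] ms]) (use qs in simp)
    have "s \<longlonglongrightarrow> 0"
    proof (rule Lim_null_comparison)
      show "\<forall>\<^sub>F k in sequentially. norm (s k) \<le> norm x * (1/2) ^ k" using s by simp
      show "(\<lambda>k. norm x * (1/2) ^ k) \<longlonglongrightarrow> 0"
        by (intro tendsto_mult_right_zero LIMSEQ_power_zero) simp
    qed
    then have "(\<lambda>k. A (s k)) \<longlonglongrightarrow> 0" using A.tendsto[of s 0] by (simp add: A.zero)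
    then have "(\<lambda>k. A (s k) - A (s (Suc k))) sums (A (s 0) - 0)" by (rule telescope_sums')
    moreover have "A (s k) - A (s (Suc k)) = B (q (s k))" for k
      by (simp add: s_def pq(1) A.diff)
    ultimately have "(\<lambda>k. B (q (s k))) sums A x" by (simp add: s_def)
    moreover have "(\<lambda>k. B (q (s k))) sums B (\<Sum>k. q (s k))"
      by (intro B.sums summable_sums summable_norm_cancel[OF sq])
    ultimately have "B (\<Sum>k. q (s k)) = A x" by (rule sums_unique2[symmetric])
    moreover have "norm (\<Sum>k. q (s k)) \<le> (2 * M + 1) * norm x"
      using summable_norm[OF sq] nq norm_ge_zero[of x] unfolding distrib_right by linarith
    ultimately show ?thesis by blast
  qed
  then show ?thesis using \<open>M \<ge> 0\<close> by (intro exI[of _ "2 * M + 1"]) auto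
qed

section \<open>Power series with vector coefficients\<close>

lemma bounded_linear_scaleC_left: "bounded_linear (\<lambda>c. c *\<^sub>C (x :: 'a::complex_normed_vector))"
proof (rule bounded_linear_intro[where K = "norm x"])
  show "(r *\<^sub>R c) *\<^sub>C x = r *\<^sub>R c *\<^sub>C x" for r c
    by (simp only: scaleR_conv_of_real scaleC_scaleC[symmetric] scaleC_of_real)
qed (simp_all add: scaleC_add_left norm_scaleC)

text \<open>Geometric majorants give convergence. On a smaller ball the differentiated series
  converges uniformly by the Weierstrass test, which justifies termwise differentiation.\<close>

lemma
  fixes a :: "nat \<Rightarrow> 'a::cbanach"
  assumes a: "\<And>k. norm (a k) \<le> C * K ^ k" and K: "K > 0"
  shows scaleC_power_series_summable:
      "\<And>z. z \<in> ball c (1 / K) \<Longrightarrow> summable (\<lambda>k. (z - c) ^ k *\<^sub>C a k)"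
    and scaleC_power_series_analytic:
      "vec_analytic_on (\<lambda>z. \<Sum>k. (z - c) ^ k *\<^sub>C a k) (ball c (1 / K))"
proof -
  show sm: "summable (\<lambda>k. (z - c) ^ k *\<^sub>C a k)" if z: "z \<in> ball c (1 / K)" for z
  proof (rule summable_norm_cancel, rule summable_comparison_test')
    have "norm (z - c) * K < 1" using z K by (simp add: dist_norm norm_minus_commute field_simps)
    then show "summable (\<lambda>k. C * (norm (z - c) * K) ^ k)"
      using K by (intro summable_mult summable_geometric) simp
    show "norm (norm ((z - c) ^ k *\<^sub>C a k)) \<le> C * (norm (z - c) * K) ^ k" for k
      using mult_left_mono[OF a[of k], of "norm (z - c) ^ k"]
      by (simp add: norm_scaleC norm_power power_mult_distrib mult_ac)
  qed
  show "vec_analytic_on (\<lambda>z. \<Sum>k. (z - c) ^ k *\<^sub>C a k) (ball c (1 / K))"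
    unfolding vec_analytic_on_def
  proof
    fix z assume z: "z \<in> ball c (1 / K)"
    then obtain r where r: "dist c z < r" "r < 1 / K" using dense by auto
    have r0: "r > 0" using r(1) zero_le_dist[of c z] by linarith
    \<comment> \<open>The termwise derivatives; at \<open>k = 0\<close> the truncated exponent is
      harmless because of the factor \<open>of_nat k\<close>.\<close>
    define b where "b k x = (of_nat k * (x - c) ^ (k - 1)) *\<^sub>C a k" for k x
    define M where "M k = C * (real k * r ^ (k - 1) * K ^ k)" for k
    have "summable (\<lambda>k. real (Suc k) * (r * K) ^ k)"
    proof -
      have "norm (r * K) < 1" using r r0 K by (simp add: field_simps)
      from geometric_deriv_sums[OF this] show ?thesis by (rule sums_summable)
    qed
    then have "summable (\<lambda>k. C * K * (real (Suc k) * (r * K) ^ k))" by (rule summable_mult)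
    moreover have "M (Suc k) = C * K * (real (Suc k) * (r * K) ^ k)" for k
      by (simp add: M_def power_mult_distrib)
    ultimately have "summable (\<lambda>k. M (Suc k))" by (simp only:)
    then have M: "summable M" by (simp only: summable_Suc_iff)
    have bM: "norm (b k x) \<le> M k" if "x \<in> ball c r" for k x
    proof -
      have "norm (x - c) \<le> r" using that by (simp add: dist_norm norm_minus_commute)
      then have "norm (x - c) ^ (k - 1) * norm (a k) \<le> r ^ (k - 1) * (C * K ^ k)"
        using a[of k] r0 by (intro mult_mono power_mono) auto
      from mult_left_mono[OF this, of "real k"] show ?thesis
        by (simp add: b_def M_def norm_scaleC norm_mult norm_power mult_ac)
    qed
    have lim: "uniform_limit (ball c r) (\<lambda>n x. \<Sum>i<n. b i x) (\<lambda>x. \<Sum>i. b i x) sequentially"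
      using bM M by (rule Weierstrass_m_test)
    have "\<exists>g. \<forall>x\<in>ball c r. (\<lambda>k. (x - c) ^ k *\<^sub>C a k) sums g x \<and>
        (g has_derivative (\<lambda>h. h *\<^sub>C (\<Sum>i. b i x))) (at x within ball c r)"
    proof (rule has_derivative_series)
      show "((\<lambda>x. (x - c) ^ n *\<^sub>C a n) has_derivative (\<lambda>h. h *\<^sub>C b n x)) (at x within ball c r)" for n x
      proof -
        have "((\<lambda>x. (x - c) ^ n) has_derivative (\<lambda>h. of_nat n * h * (x - c) ^ (n - 1))) (at x within ball c r)"
          by (auto intro!: derivative_eq_intros)
        from bounded_linear.has_derivative[OF bounded_linear_scaleC_left this, of "a n"]
        show ?thesis by (simp add: b_def scaleC_scaleC mult_ac)
      qed
      show "\<forall>\<^sub>F n in sequentially. \<forall>x\<in>ball c r. \<forall>h.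
          norm ((\<Sum>i<n. h *\<^sub>C b i x) - h *\<^sub>C (\<Sum>i. b i x)) \<le> e * norm h" if "e > 0" for e
        using uniform_limitD[OF lim that]
      proof eventually_elim
        case (elim n)
        have "norm ((\<Sum>i<n. h *\<^sub>C b i x) - h *\<^sub>C (\<Sum>i. b i x)) \<le> e * norm h" if "x \<in> ball c r" for x h
        proof -
          have "(\<Sum>i<n. h *\<^sub>C b i x) - h *\<^sub>C (\<Sum>i. b i x) = h *\<^sub>C ((\<Sum>i<n. b i x) - (\<Sum>i. b i x))"
            by (simp add: complex_vec.scale_sum_right complex_vec.scale_right_diff_distrib)
          then show ?thesis using mult_left_mono[OF less_imp_le[OF elim[rule_format, OF that]], of "norm h"]
            by (simp add: norm_scaleC dist_norm mult.commute)
        qed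
        then show ?case by blast
      qed
      show "(\<lambda>n. (z - c) ^ n *\<^sub>C a n) sums (\<Sum>k. (z - c) ^ k *\<^sub>C a k)"
        by (rule summable_sums[OF sm[OF z]])
    qed (use r in auto)
    then obtain g where g: "\<And>x. x \<in> ball c r \<Longrightarrow> (\<lambda>k. (x - c) ^ k *\<^sub>C a k) sums g x"
        "\<And>x. x \<in> ball c r \<Longrightarrow> (g has_derivative (\<lambda>h. h *\<^sub>C (\<Sum>i. b i x))) (at x within ball c r)"
      by blast
    have "(g has_derivative (\<lambda>h. h *\<^sub>C (\<Sum>i. b i z))) (at z)"
      using g(2)[of z] r(1) by (simp add: at_within_open[OF _ open_ball])
    then have "((\<lambda>z. \<Sum>k. (z - c) ^ k *\<^sub>C a k) has_derivative (\<lambda>h. h *\<^sub>C (\<Sum>i. b i z))) (at z)"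
      by (rule has_derivative_transform_within_open[OF _ open_ball[of c r]])
        (use r(1) sums_unique[OF g(1)] in auto)
    then show "\<exists>D. ((\<lambda>z. \<Sum>k. (z - c) ^ k *\<^sub>C a k) has_derivative (\<lambda>h. h *\<^sub>C D)) (at z)" by blast
  qed
qed

section \<open>Iterates and the quotients R(f^n) / R(f^(n+1))\<close>

text \<open>Makes the space of coefficient families in \<open>bounded_decomposition\<close> eligible
  for \<open>bounded_linear_lift\<close>.\<close>

instance bcontfun :: (metric_space, banach) banach ..

lemma bounded_clinearD:
  assumes "bounded_clinear f"
  shows "bounded_linear f" "f (x + y) = f x + f y" "f (x - y) = f x - f y" "f 0 = 0"
    "f (c *\<^sub>C x) = c *\<^sub>C f x" "f (\<Sum>b\<in>B. u b *\<^sub>C g b) = (\<Sum>b\<in>B. u b *\<^sub>C f (g b))"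
proof -
  show bl: "bounded_linear f" and sc: "f (c *\<^sub>C x) = c *\<^sub>C f x" for c x
    using assms by (simp_all add: bounded_clinear_def)
  interpret bounded_linear f by (rule bl)
  show "f (x + y) = f x + f y" "f (x - y) = f x - f y" "f 0 = 0"
    by (rule add diff zero)+
  show "f (\<Sum>b\<in>B. u b *\<^sub>C g b) = (\<Sum>b\<in>B. u b *\<^sub>C f (g b))"
    by (simp add: sum sc)
qed

lemma bounded_clinear_funpow:
  fixes f :: "'a::complex_normed_vector \<Rightarrow> 'a"
  shows "bounded_clinear f \<Longrightarrow> bounded_clinear (f ^^ n)"
proof (induction n)
  case 0
  have "f ^^ 0 = (\<lambda>x :: 'a. x)" by auto
  then show ?case by (metis bounded_clinear_def bounded_linear_ident)
next
  case (Suc n)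
  then have "bounded_linear (f \<circ> (f ^^ n))"
    unfolding o_def bounded_clinear_def by (blast intro: bounded_linear_compose[of f "f ^^ n"])
  with Suc show ?case by (simp add: bounded_clinear_def o_def)
qed

text \<open>
  The representatives of \<open>R(f\<^sup>d) / R(f\<^bsup>d+1\<^esup>)\<close> are pulled back along \<open>f\<^sup>d\<close>, so that one set \<open>B\<close> can
  serve for all exponents \<open>d\<close>.
\<close>

definition spans_mod_range :: "('a::complex_normed_vector \<Rightarrow> 'a) \<Rightarrow> nat \<Rightarrow> 'a set \<Rightarrow> bool"
  where "spans_mod_range f d B \<longleftrightarrow>
    (\<forall>x. \<exists>w u. (f ^^ d) x = (f ^^ Suc d) w + (\<Sum>b\<in>B. u b *\<^sub>C (f ^^ d) b))"

definition indep_mod_range :: "('a::complex_normed_vector \<Rightarrow> 'a) \<Rightarrow> nat \<Rightarrow> 'a set \<Rightarrow> bool"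
  where "indep_mod_range f d B \<longleftrightarrow>
    (\<forall>v u. (\<Sum>b\<in>B. u b *\<^sub>C (f ^^ d) b) = (f ^^ Suc d) v \<longrightarrow> (\<forall>b\<in>B. u b = 0))"

text \<open>Applying \<open>f ^^ j\<close> to a decomposition keeps its coefficients.\<close>

lemma spans_mod_range_add:
  assumes f: "bounded_clinear f" and sp: "spans_mod_range f d B"
  shows "spans_mod_range f (d + j) B"
  unfolding spans_mod_range_def
proof
  fix x
  note lin = bounded_clinearD[OF bounded_clinear_funpow[OF f, of j]]
  have shift: "(f ^^ j) ((f ^^ d) y) = (f ^^ (d + j)) y" "(f ^^ j) ((f ^^ Suc d) y) = (f ^^ Suc (d + j)) y" for y
    by (metis add.commute comp_apply funpow_add) (metis add.commute add_Suc comp_apply funpow_add)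
  obtain w u where "(f ^^ d) x = (f ^^ Suc d) w + (\<Sum>b\<in>B. u b *\<^sub>C (f ^^ d) b)"
    using sp unfolding spans_mod_range_def by meson
  then have "(f ^^ j) ((f ^^ d) x) = (f ^^ j) ((f ^^ Suc d) w + (\<Sum>b\<in>B. u b *\<^sub>C (f ^^ d) b))"
    by simp
  then have "(f ^^ (d + j)) x = (f ^^ Suc (d + j)) w + (\<Sum>b\<in>B. u b *\<^sub>C (f ^^ (d + j)) b)"
    by (simp only: lin(2,6) shift)
  then show "\<exists>w u. (f ^^ (d + j)) x = (f ^^ Suc (d + j)) w + (\<Sum>b\<in>B. u b *\<^sub>C (f ^^ (d + j)) b)"
    by blast
qed

text \<open>Exchange step: subtracting \<open>t c / u c\<close> times the dependence cancels the
  coefficient at \<open>c\<close>, and the right-hand side of the dependence is absorbed into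
  R(f^(d+1)).\<close>

lemma spans_mod_range_remove:
  assumes f: "bounded_clinear f" and B: "finite B" and sp: "spans_mod_range f d B"
    and dep: "(\<Sum>b\<in>B. u b *\<^sub>C (f ^^ d) b) = (f ^^ Suc d) v" and c: "c \<in> B" "u c \<noteq> 0"
  shows "spans_mod_range f d (B - {c})"
  unfolding spans_mod_range_def
proof
  fix x
  note lin = bounded_clinearD[OF bounded_clinear_funpow[OF f, of "Suc d"]]
  obtain w t where wt: "(f ^^ d) x = (f ^^ Suc d) w + (\<Sum>b\<in>B. t b *\<^sub>C (f ^^ d) b)"
    using sp unfolding spans_mod_range_def by meson
  define k where "k = t c / u c"
  have "(\<Sum>b\<in>B. t b *\<^sub>C (f ^^ d) b)
      = (\<Sum>b\<in>B. (t b - k * u b) *\<^sub>C (f ^^ d) b) + k *\<^sub>C (\<Sum>b\<in>B. u b *\<^sub>C (f ^^ d) b)"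
    by (simp add: complex_vec.scale_left_diff_distrib sum_subtractf complex_vec.scale_sum_right scaleC_scaleC)
  also have "(\<Sum>b\<in>B. (t b - k * u b) *\<^sub>C (f ^^ d) b) = (\<Sum>b\<in>B - {c}. (t b - k * u b) *\<^sub>C (f ^^ d) b)"
    using c by (simp add: sum.remove[OF B c(1)] k_def)
  finally have "(f ^^ d) x = (f ^^ Suc d) (w + k *\<^sub>C v) + (\<Sum>b\<in>B - {c}. (t b - k * u b) *\<^sub>C (f ^^ d) b)"
    unfolding wt dep lin(2,5) by (simp only: add_ac)
  then show "\<exists>w u. (f ^^ d) x = (f ^^ Suc d) w + (\<Sum>b\<in>B - {c}. u b *\<^sub>C (f ^^ d) b)"
    by (rule_tac x = "w + k *\<^sub>C v" in exI) (rule exI[of _ "\<lambda>b. t b - k * u b"])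
qed

text \<open>The cardinality of \<open>B\<close> is minimized over all exponents at once, so a
  dependence at any later exponent would yield a smaller spanning set. This encodes that the
  dimensions become constant.\<close>

lemma minimal_spans_mod_range:
  assumes f: "bounded_clinear f" and ex: "finite A" "spans_mod_range f n A"
  shows "\<exists>d B. finite B \<and> (\<forall>j. spans_mod_range f (d + j) B) \<and> (\<forall>j. indep_mod_range f (d + j) B)"
proof -
  define P where "P k \<longleftrightarrow> (\<exists>d B. finite B \<and> card B = k \<and> spans_mod_range f d B)" for k
  have "P (card A)" unfolding P_def using ex by blast
  then have "P (LEAST k. P k)" by (rule LeastI)
  then obtain d B where B: "finite B" "card B = (LEAST k. P k)" "spans_mod_range f d B"
    unfolding P_def by blast
  have sp: "spans_mod_range f (d + j) B" for j by (rule spans_mod_range_add[OF f B(3)])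
  have "indep_mod_range f (d + j) B" for j
    unfolding indep_mod_range_def
  proof (intro allI impI ballI, rule ccontr)
    fix v u c assume "(\<Sum>b\<in>B. u b *\<^sub>C (f ^^ (d + j)) b) = (f ^^ Suc (d + j)) v" and c: "c \<in> B" "u c \<noteq> 0"
    from spans_mod_range_remove[OF f B(1) sp this] have "P (card (B - {c}))"
      using B(1) unfolding P_def by blast
    moreover have "card (B - {c}) < (LEAST k. P k)"
      using card_Diff1_less[OF B(1) c(1)] unfolding B(2) .
    ultimately show False using not_less_Least by blast
  qed
  with B(1) sp show ?thesis by blast
qed

text \<open>If f^d x = f^(d+j) v, decompose the right-hand side and apply \<open>f\<close>: the left
  becomes 0, so the coefficients form a relation at exponent d+j+1, and independence there makes
  them vanish.\<close>

lemma kernel_subset_ranges: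
  assumes f: "bounded_clinear f" and sp: "\<And>j. spans_mod_range f (d + j) B"
    and ind: "\<And>j. indep_mod_range f (d + j) B" and x: "(f ^^ Suc d) x = 0"
  shows "\<exists>v. (f ^^ d) x = (f ^^ (d + j)) v"
proof (induction j)
  case (Suc j)
  note lin = bounded_clinearD[OF f]
  obtain v where v: "(f ^^ d) x = (f ^^ (d + j)) v" using Suc by blast
  obtain w u where wu: "(f ^^ (d + j)) v = (f ^^ Suc (d + j)) w + (\<Sum>b\<in>B. u b *\<^sub>C (f ^^ (d + j)) b)"
    using sp[of j] unfolding spans_mod_range_def by meson
  have "0 = f ((f ^^ (d + j)) v)" using x unfolding v[symmetric] by simp
  also have "\<dots> = f ((f ^^ Suc (d + j)) w) + (\<Sum>b\<in>B. u b *\<^sub>C f ((f ^^ (d + j)) b))"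
    unfolding wu by (simp only: lin(2,6))
  finally have "(\<Sum>b\<in>B. u b *\<^sub>C f ((f ^^ (d + j)) b)) = 0 - f ((f ^^ Suc (d + j)) w)"
    by (simp only: eq_diff_eq add.commute)
  also have "\<dots> = (f ^^ Suc (d + Suc j)) (0 - w)"
    using bounded_clinearD(3)[OF bounded_clinear_funpow[OF f, of "Suc (d + Suc j)"], of 0 w]
      bounded_clinearD(4)[OF bounded_clinear_funpow[OF f, of "Suc (d + Suc j)"]] by simp
  finally have "(\<Sum>b\<in>B. u b *\<^sub>C (f ^^ (d + Suc j)) b) = (f ^^ Suc (d + Suc j)) (0 - w)" by simp
  then have "\<forall>b\<in>B. u b = 0" using ind[of "Suc j"] unfolding indep_mod_range_def by blast
  then have "(\<Sum>b\<in>B. u b *\<^sub>C (f ^^ (d + j)) b) = 0" by (intro sum.neutral) simp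
  then have "(f ^^ d) x = (f ^^ (d + Suc j)) w" unfolding v wu by simp
  then show ?case by blast
qed auto

section \<open>From decompositions to a chain of bounded functionals\<close>

text \<open>Spanning says that the map \<open>G\<close>, sending a vector and a coefficient family
  to the decomposed sum, covers R(f^d); \<open>bounded_linear_lift\<close> then bounds both at once.
  The selections \<open>w\<close> and \<open>u\<close> are made pointwise and need not be
  linear.\<close>

lemma bounded_decomposition:
  fixes f :: "'a::cbanach \<Rightarrow> 'a"
  assumes f: "bounded_clinear f" and B: "finite B" and sp: "spans_mod_range f d B"
  obtains K w u where "K > 0"
    "\<And>x. (f ^^ d) x = (f ^^ Suc d) (w x) + (\<Sum>b\<in>B. u x b *\<^sub>C (f ^^ d) b)"
    "\<And>x. norm (w x) \<le> K * norm x" "\<And>x b. b \<in> B \<Longrightarrow> cmod (u x b) \<le> K * norm x"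
proof -
  \<comment> \<open>The discrete copy of \<open>'a\<close> makes \<open>'a discrete \<Rightarrow>\<^sub>C complex\<close> a Banach space holding all coefficient families on \<open>B\<close>.\<close>
  define G :: "'a \<times> ('a discrete \<Rightarrow>\<^sub>C complex) \<Rightarrow> 'a" where
    "G p = (f ^^ Suc d) (fst p) + (\<Sum>b\<in>B. apply_bcontfun (snd p) (discrete b) *\<^sub>C (f ^^ d) b)" for p
  have "bounded_linear (\<lambda>p :: 'a \<times> ('a discrete \<Rightarrow>\<^sub>C complex). apply_bcontfun (snd p) k *\<^sub>C y)" for k and y :: 'a
  proof (rule bounded_linear_compose[OF bounded_linear_scaleC_left])
    have "bounded_linear (\<lambda>g :: 'a discrete \<Rightarrow>\<^sub>C complex. apply_bcontfun g k)"
      by (rule bounded_linear_intro[where K = 1]) (simp_all add: norm_bounded)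
    then show "bounded_linear (\<lambda>p :: 'a \<times> ('a discrete \<Rightarrow>\<^sub>C complex). apply_bcontfun (snd p) k)"
      by (rule bounded_linear_compose[OF _ bounded_linear_snd])
  qed
  then have G: "bounded_linear G"
    unfolding G_def
    by (intro bounded_linear_add bounded_linear_sum
        bounded_linear_compose[OF bounded_clinearD(1)[OF bounded_clinear_funpow[OF f]] bounded_linear_fst])
  have "range (f ^^ d) \<subseteq> range G"
  proof (rule image_subsetI)
    fix x
    obtain w u where wu: "(f ^^ d) x = (f ^^ Suc d) w + (\<Sum>b\<in>B. u b *\<^sub>C (f ^^ d) b)"
      using sp unfolding spans_mod_range_def by meson
    \<comment> \<open>The value 0 off \<open>B\<close> leaves finitely many values, hence a bounded
      function; continuity is automatic on a discrete space.\<close>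
    define g where "g k = (if of_discrete k \<in> B then u (of_discrete k) else 0)" for k
    have "range g \<subseteq> insert 0 (u ` B)" by (auto simp: g_def)
    then have "finite (range g)" using B by (meson finite_imageI finite_insert finite_subset)
    then have "g \<in> bcontfun" by (simp add: bcontfun_def finite_imp_bounded continuous_on_open_vimage open_discrete)
    then have g: "apply_bcontfun (Bcontfun g) = g" by (rule Bcontfun_inverse)
    have "G (w, Bcontfun g) = (f ^^ d) x"
      unfolding G_def wu g fst_conv snd_conv
      by (intro arg_cong2[of _ _ _ _ "(+)"] refl sum.cong) (simp add: g_def discrete_inverse)
    then show "(f ^^ d) x \<in> range G" by (metis rangeI)
  qed
  from bounded_linear_lift[OF bounded_clinearD(1)[OF bounded_clinear_funpow[OF f, of d]] G this]
  obtain K where K: "K > 0" "\<forall>x. \<exists>p. G p = (f ^^ d) x \<and> norm p \<le> K * norm x" by blast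
  then obtain p where p: "\<And>x. G (p x) = (f ^^ d) x" "\<And>x. norm (p x) \<le> K * norm x" by metis
  show ?thesis
  proof (rule that[OF K(1)])
    show "(f ^^ d) x = (f ^^ Suc d) (fst (p x)) + (\<Sum>b\<in>B. apply_bcontfun (snd (p x)) (discrete b) *\<^sub>C (f ^^ d) b)" for x
      using p(1)[of x] by (simp only: G_def)
    show "norm (fst (p x)) \<le> K * norm x" for x
      using norm_fst_le[of "fst (p x)" "snd (p x)"] p(2)[of x] unfolding prod.collapse by linarith
    show "cmod (apply_bcontfun (snd (p x)) (discrete b)) \<le> K * norm x" for x b
      using norm_bounded[of "snd (p x)" "discrete b"] norm_snd_le[of "snd (p x)" "fst (p x)"] p(2)[of x]
      unfolding prod.collapse by linarith
  qed
qed

text \<open>Although \<open>w\<close> is not linear, two admissible choices differ by an element of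
  N(f^(d+1)), which \<open>kernel_subset_ranges\<close> places in N(f^d) + R(f^(k+1)). The k-th
  functional vanishes there, so the next one is independent of the choice and inherits
  linearity.\<close>

lemma functional_chain:
  fixes f :: "'a::cbanach \<Rightarrow> 'a"
  assumes f: "bounded_clinear f" and B: "finite B" "B \<noteq> {}"
    and sp: "\<And>j. spans_mod_range f (d + j) B" and ind: "\<And>j. indep_mod_range f (d + j) B"
  obtains \<phi> :: "nat \<Rightarrow> 'a cdual" and K where "K > 0" "\<And>k. norm (\<phi> k) \<le> K * K ^ k" "\<phi> 0 \<noteq> 0"
    "\<And>x. cblinfun_apply (\<phi> 0) (f x) = 0"
    "\<And>k x. cblinfun_apply (\<phi> (Suc k)) (f x) = cblinfun_apply (\<phi> k) x"
proof -
  obtain c where c: "c \<in> B" using B(2) by blast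
  note D = bounded_clinearD[OF bounded_clinear_funpow[OF f, of d]]
  note DS = bounded_clinearD[OF bounded_clinear_funpow[OF f, of "Suc d"]]
  have fs: "(f ^^ Suc d) x = (f ^^ d) (f x)" for x by (simp only: funpow_Suc_right comp_apply)
  \<comment> \<open>Unlike the selections, the relation of all admissible decompositions is linear
    (\<open>Rlin\<close>).\<close>
  define R where "R x w u \<longleftrightarrow> (f ^^ d) x = (f ^^ Suc d) w + (\<Sum>b\<in>B. u b *\<^sub>C (f ^^ d) b)" for x w u
  have sp0: "spans_mod_range f d B" using sp[of 0] by simp
  obtain K w u where K: "K > 0"
    and wu0: "\<And>x. (f ^^ d) x = (f ^^ Suc d) (w x) + (\<Sum>b\<in>B. u x b *\<^sub>C (f ^^ d) b)"
    and nw: "\<And>x. norm (w x) \<le> K * norm x" and nu: "\<And>x b. b \<in> B \<Longrightarrow> cmod (u x b) \<le> K * norm x"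
    using bounded_decomposition[OF f B(1) sp0] by blast
  have wu: "R x (w x) (u x)" for x unfolding R_def by (rule wu0)
  have uniq: "(f ^^ Suc d) (w1 - w2) = 0 \<and> u1 c = u2 c" if "R x w1 u1" "R x w2 u2" for x w1 w2 u1 u2
  proof -
    have *: "(\<Sum>b\<in>B. (u1 b - u2 b) *\<^sub>C (f ^^ d) b) = (f ^^ Suc d) (w2 - w1)"
      using that unfolding R_def DS(3) complex_vec.scale_left_diff_distrib sum_subtractf
      by (metis (no_types, lifting) add_diff_cancel_left' add_diff_eq diff_diff_eq2 add.commute)
    have "indep_mod_range f d B" using ind[of 0] by simp
    then have z: "\<forall>b\<in>B. u1 b - u2 b = 0"
      unfolding indep_mod_range_def using * by (elim allE impE)
    then have "(\<Sum>b\<in>B. (u1 b - u2 b) *\<^sub>C (f ^^ d) b) = 0" by (intro sum.neutral) simp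
    with * z c show ?thesis unfolding DS(3) by simp
  qed
  have Rlin: "R (a *\<^sub>C x + y) (a *\<^sub>C w1 + w2) (\<lambda>b. a * u1 b + u2 b)" if "R x w1 u1" "R y w2 u2" for a x y w1 w2 u1 u2
    using that unfolding R_def D(2,5) DS(2,5)
    by (simp add: scaleC_add_right scaleC_add_left sum.distrib complex_vec.scale_sum_right scaleC_scaleC add_ac)
  \<comment> \<open>The \<open>c\<close>-coefficient found after passing to the remainder
    \<open>w\<close> exactly \<open>k\<close> times.\<close>
  define g where "g k x = u ((w ^^ k) x) c" for k x
  have gS: "g (Suc k) x = g k (w x)" for k x by (simp only: g_def funpow_Suc_right comp_apply)
  \<comment> \<open>The induction invariant: linearity together with vanishing on N(f^d) and on
    R(f^(k+1)), which is what \<open>step\<close> consumes.\<close>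
  define Q where "Q k \<longleftrightarrow> (\<forall>a x y. g k (a *\<^sub>C x + y) = a * g k x + g k y) \<and>
      (\<forall>x. (f ^^ d) x = 0 \<longrightarrow> g k x = 0) \<and> (\<forall>v. g k ((f ^^ Suc k) v) = 0)" for k
  have step: "g (Suc k) x = g k w'" if Q: "Q k" and R: "R x w' u'" for k x w' u'
  proof -
    let ?y = "w x - w'"
    have lin: "g k (a *\<^sub>C x + y) = a * g k x + g k y" for a x y using Q unfolding Q_def by blast
    have "(f ^^ Suc d) ?y = 0" using uniq[OF wu R] by blast
    then obtain v where v: "(f ^^ d) ?y = (f ^^ (d + Suc k)) v"
      using kernel_subset_ranges[OF f sp ind] by blast
    then have "(f ^^ d) (?y - (f ^^ Suc k) v) = 0" unfolding D(3) by (simp only: funpow_add comp_apply diff_self)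
    then have 1: "g k (?y - (f ^^ Suc k) v) = 0" using Q unfolding Q_def by blast
    have "g k ((f ^^ Suc k) v) = 0" using Q unfolding Q_def by blast
    then have "g k ?y = 0" using lin[of 1 "?y - (f ^^ Suc k) v" "(f ^^ Suc k) v"] 1 by simp
    then show ?thesis using lin[of 1 ?y w'] by (simp add: gS)
  qed
  \<comment> \<open>This decomposition of \<open>f x\<close> makes composition with \<open>f\<close>
    lower the index of the chain by one, or give 0 at index 0.\<close>
  have R_image: "R (f x) x (\<lambda>_. 0)" for x by (simp only: R_def fs) simp
  have R_kernel: "R x 0 (\<lambda>_. 0)" if "(f ^^ d) x = 0" for x
    using that by (simp only: R_def DS(4)) simp
  have Q: "Q k" for k
  proof (induction k)
    case 0
    have "g 0 x = u' c" if "R x w' u'" for x w' u'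
      using uniq[OF wu[of x] that] by (simp add: g_def)
    from this[OF Rlin[OF wu wu]] this[OF R_kernel] this[OF R_image]
    show ?case unfolding Q_def by (auto simp: g_def)
  next
    case (Suc k)
    note st = step[OF Suc]
    have lin: "g k (a *\<^sub>C x + y) = a * g k x + g k y" for a x y using Suc unfolding Q_def by blast
    have g0: "g k 0 = 0" using lin[of 1 0 0] by simp
    have "g (Suc k) (a *\<^sub>C x + y) = a * g (Suc k) x + g (Suc k) y" for a x y
      using st[OF Rlin[OF wu wu]] by (simp add: lin gS)
    moreover have "g (Suc k) x = 0" if "(f ^^ d) x = 0" for x
      using st[OF R_kernel[OF that]] g0 by simp
    moreover have "g (Suc k) ((f ^^ Suc (Suc k)) v) = 0" for v
      using st[OF R_image[of "(f ^^ Suc k) v"]] Suc unfolding Q_def by simp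
    ultimately show ?case unfolding Q_def by blast
  qed
  have lin: "g k (a *\<^sub>C x + y) = a * g k x + g k y" for k a x y using Q[of k] unfolding Q_def by blast
  have g0: "g k 0 = 0" for k using lin[of k 1 0 0] by simp
  have nwk: "norm ((w ^^ k) x) \<le> K ^ k * norm x" for k x
  proof (induction k)
    case (Suc k)
    show ?case using order.trans[OF nw[of "(w ^^ k) x"] mult_left_mono[OF Suc, of K]] K by (simp add: mult.assoc)
  qed simp
  have ng: "norm (g k x) \<le> norm x * (K * K ^ k)" for k x
    using order.trans[OF nu[OF c, of "(w ^^ k) x"] mult_left_mono[OF nwk[of k x], of K]] K by (simp add: g_def mult_ac)
  have "bounded_clinear (g k)" for k
    unfolding bounded_clinear_def
  proof (intro conjI allI)
    show sc: "g k (a *\<^sub>C x) = a *\<^sub>C g k x" for a x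
      using lin[of k a x 0] g0 by (simp add: scaleC_complex_def)
    show "bounded_linear (g k)"
    proof (rule bounded_linear_intro[OF _ _ ng])
      show "g k (x + y) = g k x + g k y" for x y using lin[of k 1 x y] by simp
      show "g k (r *\<^sub>R x) = r *\<^sub>R g k x" for r x
        using sc[of "of_real r" x] by (simp only: scaleC_of_real)
    qed
  qed
  then have app: "cblinfun_apply (Cblinfun (g k)) = g k" for k by (simp add: Cblinfun_inverse)
  show ?thesis
  proof (rule that[of K "\<lambda>k. Cblinfun (g k)", OF K])
    show "norm (Cblinfun (g k)) \<le> K * K ^ k" for k
      by (rule norm_cblinfun_bound) (use ng K in \<open>simp_all add: app mult.commute\<close>)
    \<comment> \<open>The vector \<open>c\<close> is its own representative, so \<open>g 0\<close>
      takes the value 1 there.\<close>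
    have "R c 0 (\<lambda>b. if b = c then 1 else 0)"
      unfolding R_def DS(4) using B(1) c by (simp add: if_distrib[of "\<lambda>a. a *\<^sub>C _"] cong: if_cong)
    then have "g 0 c = 1" using uniq[OF wu] by (auto simp: g_def)
    then show "Cblinfun (g 0) \<noteq> 0" using app[of 0] by (metis zero_cblinfun.rep_eq zero_neq_one)
    show "cblinfun_apply (Cblinfun (g 0)) (f x) = 0" for x
      using uniq[OF wu R_image[of x]] by (simp add: app g_def)
    show "cblinfun_apply (Cblinfun (g (Suc k))) (f x) = cblinfun_apply (Cblinfun (g k)) x" for k x
      unfolding app by (rule step[OF Q R_image])
  qed
qed

section \<open>The SVEP of the adjoint: failure from a chain, validity from surjectivity\<close>

lemma bounded_linear_cblinfun_eval: "bounded_linear (\<lambda>\<phi>. cblinfun_apply \<phi> x)"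
  by (rule bounded_linear_intro[where K = "norm x"])
    (simp_all add: plus_cblinfun.rep_eq scaleR_cblinfun.rep_eq norm_cblinfun)

lemma adjoint_resolvent_apply:
  "cblinfun_apply (cblinfun_apply (z *\<^sub>C id_cblinfun - banach_adjoint T) \<phi>) x
    = cblinfun_apply \<phi> (cblinfun_apply (z *\<^sub>C id_cblinfun - T) x)"
  using bounded_clinearD(3,5)[OF bounded_clinear_cblinfun_apply[of \<phi>]]
  by (simp add: minus_cblinfun.rep_eq scaleC_cblinfun.rep_eq id_cblinfun.rep_eq
      banach_adjoint.rep_eq cblinfun_compose.rep_eq)

text \<open>With S = \<mu> - T, the series F satisfies F(z) S = -(z - \<mu>) F(z), while z - T = (z
  - \<mu>) + S; hence F(z) annihilates the range of z - T.\<close>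

lemma not_svep_at_adjoint:
  fixes T :: "('a::cbanach, 'a) cblinfun" and \<phi> :: "nat \<Rightarrow> 'a cdual"
  assumes K: "K > 0" and n: "\<And>k. norm (\<phi> k) \<le> C * K ^ k" and nz: "\<phi> 0 \<noteq> 0"
    and z: "\<And>x. cblinfun_apply (\<phi> 0) (cblinfun_apply (\<mu> *\<^sub>C id_cblinfun - T) x) = 0"
    and s: "\<And>k x. cblinfun_apply (\<phi> (Suc k)) (cblinfun_apply (\<mu> *\<^sub>C id_cblinfun - T) x) = cblinfun_apply (\<phi> k) x"
  shows "\<not> svep_at (banach_adjoint T) \<mu>"
proof
  assume svep: "svep_at (banach_adjoint T) \<mu>"
  let ?S = "cblinfun_apply (\<mu> *\<^sub>C id_cblinfun - T)"
  \<comment> \<open>The signs turn powers of \<mu> - z into powers of z - \<mu>.\<close>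
  define \<psi> where "\<psi> k = (-1) ^ k *\<^sub>C \<phi> k" for k
  have n': "norm (\<psi> k) \<le> C * K ^ k" for k using n[of k] by (simp add: \<psi>_def norm_scaleC norm_power)
  define F where "F z = (\<Sum>k. (z - \<mu>) ^ k *\<^sub>C \<psi> k)" for z
  have "cblinfun_apply (z *\<^sub>C id_cblinfun - banach_adjoint T) (F z) = 0" if zb: "z \<in> ball \<mu> (1 / K)" for z
  proof (rule cblinfun_eqI)
    fix x
    have sm: "(\<lambda>k. (z - \<mu>) ^ k * cblinfun_apply (\<psi> k) y) sums cblinfun_apply (F z) y" for y
      using bounded_linear.sums[OF bounded_linear_cblinfun_eval summable_sums[OF scaleC_power_series_summable[OF n' K zb]], of y]
      by (simp add: F_def scaleC_cblinfun.rep_eq scaleC_complex_def)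
    \<comment> \<open>The term of index 0 vanishes by \<open>z\<close>, so the series may start at
      1.\<close>
    have "(\<lambda>k. (z - \<mu>) ^ Suc k * cblinfun_apply (\<psi> (Suc k)) (?S x)) sums cblinfun_apply (F z) (?S x)"
      using sm[of "?S x"] z[of x]
      by (subst sums_Suc_iff) (simp add: \<psi>_def)
    moreover have "(z - \<mu>) ^ Suc k * cblinfun_apply (\<psi> (Suc k)) (?S x)
        = - (z - \<mu>) * ((z - \<mu>) ^ k * cblinfun_apply (\<psi> k) x)" for k
      by (simp add: \<psi>_def scaleC_cblinfun.rep_eq uminus_cblinfun.rep_eq scaleC_complex_def s algebra_simps)
    ultimately have "(\<lambda>k. - (z - \<mu>) * ((z - \<mu>) ^ k * cblinfun_apply (\<psi> k) x)) sums cblinfun_apply (F z) (?S x)"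
      by (simp only:)
    then have FS: "cblinfun_apply (F z) (?S x) = - (z - \<mu>) * cblinfun_apply (F z) x"
      using sums_unique2 sums_mult[OF sm[of x]] by blast
    have "cblinfun_apply (z *\<^sub>C id_cblinfun - T) x = (z - \<mu>) *\<^sub>C x + ?S x"
      by (simp add: minus_cblinfun.rep_eq scaleC_cblinfun.rep_eq id_cblinfun.rep_eq
          complex_vec.scale_left_diff_distrib)
    then show "cblinfun_apply (cblinfun_apply (z *\<^sub>C id_cblinfun - banach_adjoint T) (F z)) x = cblinfun_apply 0 x"
      using bounded_clinearD(2,5)[OF bounded_clinear_cblinfun_apply[of "F z"]]
      by (simp add: adjoint_resolvent_apply FS zero_cblinfun.rep_eq scaleC_complex_def)
        (simp add: algebra_simps)
  qed
  moreover have "vec_analytic_on F (ball \<mu> (1 / K))"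
    unfolding F_def by (rule scaleC_power_series_analytic[OF n' K])
  ultimately have "F \<mu> = 0"
    using svep K unfolding svep_at_def by (metis centre_in_ball zero_less_divide_1_iff)
  moreover have "F \<mu> = \<psi> 0"
    unfolding F_def by (subst suminf_finite[of "{0}"]) simp_all
  ultimately show False using nz by (simp add: \<psi>_def)
qed

text \<open>First R(f^n) is covered, by a geometric series built from a bounded solution
  \<open>g\<close> of f^(n+1) y = f^n x; then \<open>desc_step\<close> climbs back from R(f^n) to
  the whole space.\<close>

lemma surj_near_if_descent:
  fixes f :: "'a::cbanach \<Rightarrow> 'a"
  assumes f: "bounded_clinear f" and desc: "range (f ^^ n) \<subseteq> range (f ^^ Suc n)"
  shows "\<exists>\<delta>>0. \<forall>\<mu>. \<mu> \<noteq> 0 \<and> cmod \<mu> < \<delta> \<longrightarrow> surj (\<lambda>x. f x - \<mu> *\<^sub>C x)"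
proof -
  note D = bounded_clinearD[OF f]
  note Dn = bounded_clinearD[OF bounded_clinear_funpow[OF f, of n]]
  note DS = bounded_clinearD[OF bounded_clinear_funpow[OF f, of "Suc n"]]
  obtain K where K: "K > 0" "\<forall>x. \<exists>y. (f ^^ Suc n) y = (f ^^ n) x \<and> norm y \<le> K * norm x"
    using bounded_linear_lift[OF Dn(1) DS(1) desc] by blast
  then obtain g where g: "\<And>x. (f ^^ Suc n) (g x) = (f ^^ n) x" "\<And>x. norm (g x) \<le> K * norm x"
    by metis
  have "surj (\<lambda>x. f x - \<mu> *\<^sub>C x)" if \<mu>: "\<mu> \<noteq> 0" "cmod \<mu> < 1 / K" for \<mu>
  proof -
    define P where "P x \<longleftrightarrow> (\<exists>y. f y - \<mu> *\<^sub>C y = x)" for x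
    have base: "P ((f ^^ n) x)" for x
    proof -
      define s where "s k = (g ^^ k) x" for k
      have ns: "norm (s k) \<le> norm x * K ^ k" for k
      proof (induction k)
        case (Suc k)
        show ?case using order.trans[OF g(2)[of "s k"] mult_left_mono[OF Suc, of K]] K(1) by (simp add: s_def mult_ac)
      qed (simp add: s_def)
      have "norm (s (Suc k)) \<le> (norm x * K) * K ^ k" for k using ns[of "Suc k"] by (simp add: mult_ac)
      from scaleC_power_series_summable[OF this K(1), of \<mu> 0] have
        sm: "summable (\<lambda>k. \<mu> ^ k *\<^sub>C s (Suc k))" using \<mu> by simp
      \<comment> \<open>Under f^(n+1) each index drops by one, so f^(n+1) v = f^n x + \<mu> f^n v
        and f^n v is the preimage sought.\<close>
      define v where "v = (\<Sum>k. \<mu> ^ k *\<^sub>C s (Suc k))"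
      have sv: "(\<lambda>k. \<mu> ^ k *\<^sub>C s (Suc k)) sums v" unfolding v_def by (rule summable_sums[OF sm])
      have "(\<lambda>k. \<mu> ^ k *\<^sub>C (f ^^ n) (s k)) sums (f ^^ Suc n) v"
      proof -
        have "(f ^^ Suc n) (\<mu> ^ k *\<^sub>C s (Suc k)) = \<mu> ^ k *\<^sub>C (f ^^ n) (s k)" for k
          unfolding DS(5) using g(1)[of "s k"] by (simp add: s_def)
        then show ?thesis using bounded_linear.sums[OF DS(1) sv] by simp
      qed
      then have "(\<lambda>k. \<mu> ^ Suc k *\<^sub>C (f ^^ n) (s (Suc k))) sums ((f ^^ Suc n) v - (f ^^ n) x)"
        by (subst sums_Suc_iff) (simp add: s_def)
      moreover have "(\<lambda>k. \<mu> ^ Suc k *\<^sub>C (f ^^ n) (s (Suc k))) sums (\<mu> *\<^sub>C (f ^^ n) v)"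
        using bounded_linear.sums[OF bounded_linear_scaleC bounded_linear.sums[OF Dn(1) sv], of \<mu>]
        by (simp add: Dn(5) scaleC_scaleC)
      ultimately have "(f ^^ Suc n) v - (f ^^ n) x = \<mu> *\<^sub>C (f ^^ n) v" by (rule sums_unique2)
      then have "f ((f ^^ n) v) - \<mu> *\<^sub>C (f ^^ n) v = (f ^^ n) x" by (simp add: algebra_simps)
      then show ?thesis unfolding P_def by blast
    qed
    \<comment> \<open>If f x = (f - \<mu>) y, then \<mu> x = (f - \<mu>)(y - x), and \<mu> can be
      divided out.\<close>
    have desc_step: "P x" if "P (f x)" for x
    proof -
      obtain y where y: "f y - \<mu> *\<^sub>C y = f x" using \<open>P (f x)\<close> unfolding P_def by blast
      have "f (inverse \<mu> *\<^sub>C (y - x)) - \<mu> *\<^sub>C inverse \<mu> *\<^sub>C (y - x) = inverse \<mu> *\<^sub>C (f y - f x - \<mu> *\<^sub>C (y - x))"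
        by (simp add: D(3,5) complex_vec.scale_right_diff_distrib scaleC_scaleC mult.commute)
      also have "f y - f x - \<mu> *\<^sub>C (y - x) = \<mu> *\<^sub>C x"
        using y by (simp add: complex_vec.scale_right_diff_distrib algebra_simps)
      finally show ?thesis using \<mu>(1) unfolding P_def
        by (intro exI[of _ "inverse \<mu> *\<^sub>C (y - x)"]) (simp add: scaleC_scaleC)
    qed
    have "(\<forall>x. P ((f ^^ m) x)) \<Longrightarrow> P x" for m x
      by (induction m) (auto intro: desc_step)
    then have "P x" for x using base by blast
    then show ?thesis unfolding P_def surj_def by metis
  qed
  then show ?thesis using K(1) by (intro exI[of _ "1 / K"]) simp
qed

text \<open>A functional that annihilates the range of an onto operator is 0, so a solution F
  vanishes near \<nu> except possibly at \<mu>. The identity theorem for the scalar functions F(z) x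
  extends this to the whole disc.\<close>

lemma svep_at_adjoint_if_surj_near:
  fixes T :: "('a::complex_normed_vector, 'a) cblinfun"
  assumes surj: "\<And>z. z \<in> ball \<mu> \<delta> \<Longrightarrow> z \<noteq> \<mu> \<Longrightarrow> surj (cblinfun_apply (z *\<^sub>C id_cblinfun - T))"
    and \<nu>: "\<nu> \<in> ball \<mu> \<delta>"
  shows "svep_at (banach_adjoint T) \<nu>"
  unfolding svep_at_def
proof (intro allI impI ballI)
  fix r :: real and F :: "complex \<Rightarrow> 'a cdual" and w
  assume r: "r > 0" and F: "vec_analytic_on F (ball \<nu> r) \<and>
      (\<forall>z\<in>ball \<nu> r. cblinfun_apply (z *\<^sub>C id_cblinfun - banach_adjoint T) (F z) = 0)"
    and w: "w \<in> ball \<nu> r"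
  let ?U = "ball \<nu> r \<inter> ball \<mu> \<delta> - {\<mu>}"
  have F0: "F z = 0" if "z \<in> ?U" for z
  proof (rule cblinfun_eqI)
    fix x
    have "surj (cblinfun_apply (z *\<^sub>C id_cblinfun - T))" using surj that by blast
    then obtain y where y: "x = cblinfun_apply (z *\<^sub>C id_cblinfun - T) y" by (rule surjE)
    have "cblinfun_apply (z *\<^sub>C id_cblinfun - banach_adjoint T) (F z) = 0" using F that by blast
    then show "cblinfun_apply (F z) x = cblinfun_apply 0 x"
      using adjoint_resolvent_apply[of z T "F z" y] y by (simp add: zero_cblinfun.rep_eq)
  qed
  have opU: "open ?U" by (intro open_Diff open_Int open_ball closed_singleton)
  have "\<nu> \<in> ball \<nu> r \<inter> ball \<mu> \<delta>" using r \<nu> by simp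
  then have "open (ball \<nu> r \<inter> ball \<mu> \<delta>)" "ball \<nu> r \<inter> ball \<mu> \<delta> \<noteq> {}" by blast+
  \<comment> \<open>Covers \<nu> = \<mu> too: a nonempty open set is not contained in a single
    point.\<close>
  then have "?U \<noteq> {}" by (metis Diff_eq_empty_iff not_open_singleton subset_singletonD)
  show "F w = 0"
  proof (rule cblinfun_eqI)
    fix x
    have hol: "(\<lambda>z. cblinfun_apply (F z) x) holomorphic_on ball \<nu> r"
    proof (rule holomorphic_onI)
      fix z assume "z \<in> ball \<nu> r"
      then obtain D where "(F has_derivative (\<lambda>h. h *\<^sub>C D)) (at z)"
        using F unfolding vec_analytic_on_def by blast
      from bounded_linear.has_derivative[OF bounded_linear_cblinfun_eval this]
      have "((\<lambda>z. cblinfun_apply (F z) x) has_field_derivative cblinfun_apply D x) (at z)"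
        by (simp add: has_field_derivative_def scaleC_cblinfun.rep_eq scaleC_complex_def mult_commute_abs)
      then show "(\<lambda>z. cblinfun_apply (F z) x) field_differentiable (at z within ball \<nu> r)"
        by (meson field_differentiable_at_within field_differentiable_def)
    qed
    have "cblinfun_apply (F w) x = 0"
    proof (rule analytic_continuation_open[where f = "\<lambda>z. cblinfun_apply (F z) x" and g = "\<lambda>_. 0" and z = w, OF opU open_ball \<open>?U \<noteq> {}\<close> connected_ball])
      show "cblinfun_apply (F z) x = 0" if "z \<in> ?U" for z
        using F0[OF that] by (simp add: zero_cblinfun.rep_eq)
    qed (use w hol in auto)
    then show "cblinfun_apply (F w) x = cblinfun_apply 0 x" by (simp add: zero_cblinfun.rep_eq)
  qed
qed

section \<open>Descent and essential descent in terms of ranges\<close>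

lemma Inf_enat_Collect_eq_infinity: "Inf {enat n | n. P n} = \<infinity> \<longleftrightarrow> (\<nexists>n. P n)"
proof -
  have "Inf {enat n | n. P n} = \<infinity> \<longleftrightarrow> (\<forall>x\<in>{enat n | n. P n}. x = \<infinity>)"
    unfolding top_enat_def[symmetric] by (rule Inf_top_conv)
  then show ?thesis by auto
qed

text \<open>A nonempty set of extended naturals attains its infimum, so dimension 0 makes the empty
  set a basis.\<close>

lemma quotient_dim_eq_0_iff: "0 \<in> W \<Longrightarrow> quotient_dim V W = 0 \<longleftrightarrow> V \<subseteq> W"
proof
  assume *: "quotient_dim V W = 0"
  define D where "D = {enat (card B) | B. finite B \<and> quotient_basis V W B}"
  have D: "Inf D = 0" using * by (simp add: quotient_dim_def D_def)
  then have "D \<noteq> {}" by (metis Inf_empty top_enat_def infinity_ne_i0)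
  then obtain k where "k \<in> D" by blast
  then have "Inf D \<in> D" by (rule wellorder_InfI)
  then have "0 \<in> {enat (card B) | B. finite B \<and> quotient_basis V W B}"
    by (simp only: D) (simp only: D_def)
  then have "quotient_basis V W {}" by (auto simp: zero_enat_def)
  then show "V \<subseteq> W" by (auto simp: quotient_basis_def)
next
  assume "0 \<in> W" "V \<subseteq> W"
  then have "quotient_basis V W {}" by (auto simp: quotient_basis_def)
  then have "0 \<in> {enat (card B) | B. finite B \<and> quotient_basis V W B}"
    by (auto simp: zero_enat_def intro!: exI[of _ "{}"])
  then have "quotient_dim V W \<le> 0" unfolding quotient_dim_def by (rule Inf_lower)
  then show "quotient_dim V W = 0" by simp
qed

lemma descent_eq_infinity_iff:
  "descent S = \<infinity> \<longleftrightarrow> (\<nexists>n. range (cblinfun_apply S ^^ n) \<subseteq> range (cblinfun_apply S ^^ Suc n))"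
proof -
  have "0 \<in> range (cblinfun_apply S ^^ n)" for n
    using bounded_clinearD(4)[OF bounded_clinear_funpow[OF bounded_clinear_cblinfun_apply[of S]], of n]
    by (metis rangeI)
  then show ?thesis
    by (simp only: descent_def Inf_enat_Collect_eq_infinity descent_dim_def quotient_dim_eq_0_iff range_pow_def)
qed

lemma ess_descent_eq_infinity_imp: "ess_descent S = \<infinity> \<Longrightarrow> descent S = \<infinity>"
  unfolding descent_def ess_descent_def Inf_enat_Collect_eq_infinity
  by (metis enat_0_iff(1) infinity_ne_i0 i0_less enat_ord_simps(4) zero_enat_def)

lemma spans_mod_range_if_ess_descent:
  assumes "ess_descent S \<noteq> \<infinity>"
  obtains n A where "finite A" "spans_mod_range (cblinfun_apply S) n A"
proof -
  let ?f = "cblinfun_apply S"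
  obtain n where "quotient_dim (range_pow S n) (range_pow S (Suc n)) < \<infinity>"
    using assms unfolding ess_descent_def Inf_enat_Collect_eq_infinity descent_dim_def by blast
  then have "{enat (card B) | B. finite B \<and> quotient_basis (range_pow S n) (range_pow S (Suc n)) B} \<noteq> {}"
    unfolding quotient_dim_def by (metis Inf_empty top_enat_def order_less_irrefl)
  then obtain B where B: "finite B" "quotient_basis (range_pow S n) (range_pow S (Suc n)) B" by blast
  have "B \<subseteq> range (?f ^^ n)" using B(2) by (auto simp: quotient_basis_def range_pow_def)
  \<comment> \<open>Any choice of preimages works; \<open>p\<close> is injective on \<open>B\<close>
    because \<open>?f ^^ n\<close> undoes it.\<close>
  define p where "p = inv (?f ^^ n)"
  have p: "(?f ^^ n) (p b) = b" if "b \<in> B" for b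
    using \<open>B \<subseteq> range (?f ^^ n)\<close> that unfolding p_def by (meson f_inv_into_f subsetD)
  have "inj_on p B" using p by (metis inj_onI)
  have "spans_mod_range ?f n (p ` B)"
    unfolding spans_mod_range_def
  proof
    fix x
    have "\<exists>F u. finite F \<and> F \<subseteq> B \<and> (?f ^^ n) x - (\<Sum>b\<in>F. u b *\<^sub>C b) \<in> range (?f ^^ Suc n)"
      using B(2) unfolding quotient_basis_def range_pow_def by blast
    then obtain F u where F: "F \<subseteq> B" "(?f ^^ n) x - (\<Sum>b\<in>F. u b *\<^sub>C b) \<in> range (?f ^^ Suc n)" by blast
    then obtain w where w: "(?f ^^ n) x - (\<Sum>b\<in>F. u b *\<^sub>C b) = (?f ^^ Suc n) w" by blast
    define t where "t y = (if (?f ^^ n) y \<in> F then u ((?f ^^ n) y) else 0)" for y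
    have "(\<Sum>y\<in>p ` B. t y *\<^sub>C (?f ^^ n) y) = (\<Sum>b\<in>B. (if b \<in> F then u b else 0) *\<^sub>C b)"
      unfolding sum.reindex[OF \<open>inj_on p B\<close>] o_def by (intro sum.cong) (simp_all add: t_def p)
    also have "\<dots> = (\<Sum>b\<in>F. u b *\<^sub>C b)"
      using F(1) B(1) by (intro sum.mono_neutral_cong_right) auto
    finally have "(?f ^^ n) x = (?f ^^ Suc n) w + (\<Sum>y\<in>p ` B. t y *\<^sub>C (?f ^^ n) y)"
      using w by (metis diff_add_cancel)
    then show "\<exists>w u. (?f ^^ n) x = (?f ^^ Suc n) w + (\<Sum>b\<in>p ` B. u b *\<^sub>C (?f ^^ n) b)" by blast
  qed
  then show ?thesis using B(1) that by blast
qed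

theorem theorem2:
  fixes T :: "('a::cbanach, 'a) cblinfun"
  shows "descent_spectrum T = ess_descent_spectrum T \<union> closure (svep_failure_set (banach_adjoint T)) \<and>
    (svep (banach_adjoint T) \<longrightarrow> descent_spectrum T = ess_descent_spectrum T)"
proof -
  have "\<mu> \<in> svep_failure_set (banach_adjoint T)"
    if \<mu>: "\<mu> \<in> descent_spectrum T" "\<mu> \<notin> ess_descent_spectrum T" for \<mu>
  proof -
    let ?S = "\<mu> *\<^sub>C id_cblinfun - T"
    note f = bounded_clinear_cblinfun_apply[of ?S]
    obtain n A where "finite A" "spans_mod_range (cblinfun_apply ?S) n A"
      using \<mu>(2) spans_mod_range_if_ess_descent[of ?S] unfolding ess_descent_spectrum_def by blast
    from minimal_spans_mod_range[OF f this] obtain d B where B: "finite B"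
      and sp: "\<And>j. spans_mod_range (cblinfun_apply ?S) (d + j) B"
      and ind: "\<And>j. indep_mod_range (cblinfun_apply ?S) (d + j) B"
      by blast
    have "B \<noteq> {}"
    proof
      assume "B = {}"
      then have "range (cblinfun_apply ?S ^^ d) \<subseteq> range (cblinfun_apply ?S ^^ Suc d)"
        using sp[of 0] unfolding spans_mod_range_def by auto
      then show False using \<mu>(1) unfolding descent_spectrum_def mem_Collect_eq descent_eq_infinity_iff by blast
    qed
    from functional_chain[OF f B this sp ind] not_svep_at_adjoint[of _ _ _ \<mu> T]
    show ?thesis unfolding svep_failure_set_def mem_Collect_eq by metis
  qed
  moreover have "ess_descent_spectrum T \<subseteq> descent_spectrum T"
    unfolding descent_spectrum_def ess_descent_spectrum_def using ess_descent_eq_infinity_imp by blast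
  moreover have "closure (svep_failure_set (banach_adjoint T)) \<subseteq> descent_spectrum T"
  proof (rule ccontr)
    assume "\<not> ?thesis"
    then obtain \<mu> where \<mu>: "\<mu> \<in> closure (svep_failure_set (banach_adjoint T))" "\<mu> \<notin> descent_spectrum T" by blast
    let ?S = "\<mu> *\<^sub>C id_cblinfun - T"
    obtain n where "range (cblinfun_apply ?S ^^ n) \<subseteq> range (cblinfun_apply ?S ^^ Suc n)"
      using \<mu>(2) unfolding descent_spectrum_def mem_Collect_eq descent_eq_infinity_iff by blast
    from surj_near_if_descent[OF bounded_clinear_cblinfun_apply this] obtain \<delta> where
      \<delta>: "\<delta> > 0" "\<And>z. z \<noteq> 0 \<Longrightarrow> cmod z < \<delta> \<Longrightarrow> surj (\<lambda>x. cblinfun_apply ?S x - z *\<^sub>C x)" by blast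
    have "surj (cblinfun_apply (z *\<^sub>C id_cblinfun - T))" if "z \<in> ball \<mu> \<delta>" "z \<noteq> \<mu>" for z
    proof -
      have "cblinfun_apply (z *\<^sub>C id_cblinfun - T) = (\<lambda>x. cblinfun_apply ?S x - (\<mu> - z) *\<^sub>C x)"
        by (simp add: fun_eq_iff minus_cblinfun.rep_eq scaleC_cblinfun.rep_eq id_cblinfun.rep_eq
            complex_vec.scale_left_diff_distrib)
      then show ?thesis using \<delta>(2)[of "\<mu> - z"] that by (simp add: dist_norm)
    qed
    \<comment> \<open>The SVEP holds on a full ball, centre included, which excludes \<mu> from the
      closure as well.\<close>
    then have "ball \<mu> \<delta> \<inter> svep_failure_set (banach_adjoint T) = {}"
      using svep_at_adjoint_if_surj_near[of \<mu> \<delta> T] unfolding svep_failure_set_def by blast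
    then show False using \<mu>(1) \<delta>(1) by (metis centre_in_ball closure_iff_nhds_not_empty open_ball subset_refl inf_commute)
  qed
  ultimately have "descent_spectrum T = ess_descent_spectrum T \<union> closure (svep_failure_set (banach_adjoint T))"
    using closure_subset by blast
  then show ?thesis by (simp add: svep_def)
qed

end
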